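(* Suppose that there are constants $C\ge 1$, $\mathcal{Q}\ge 1$ and non-negative numbers $q_{i,k}$ ($1\le k\le i$) such that $$\sum_{k=1}^i k(i-k+1)q_{i,k}\le \mathcal{Q}\,i\quad\text{for all } i\in\mathbb{N}_+,$$ and $$a(i,j;k)\le C(i-k+1)(j+k)q_{i,k}\quad\text{for all integers } 1\le k\le i \text{ and all } j\in\mathbb{N}$$ (including $j=0$). Let $T\in(0,+\infty]$ and $c^{\mathrm{in}}\in X_{0,1}^+$. If $c=(c_i)$ is a mild solution on $[0,T)$ of the DGED system with initial condition $c(0)=c^{\mathrm{in}}$, in either the isolated or the non-isolated case, and if $t\mapsto\sum_{i=1}^\infty i\,c_i(t)$ is constant in $[0,T)$, then, for each $i\in\mathbb{N}$, $c_i\in C^1([0,T),\mathbb{R}^+_0)$, where $\mathbb{R}_0^+=[0,\infty)$.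
   Context: Notation: $\mathbb{N}=\{0,1,2,\dots\}$, $\mathbb{N}_+=\mathbb{N}\setminus\{0\}$. Rate coefficients: real numbers $a(p,q;k)\ge 0$ are given for all integers $p\ge1$, $q\ge 0$, $1\le k\le p$. Standing assumptions: $a(p,0;p)=0$ for all $p\in\mathbb{N}_+$; $a(k,j;k)=a(j,k;j)$ for all $j,k\in\mathbb{N}_+$; $a(i,0;k)=a(i,0;i-k)$ for all $i\in\mathbb{N}_+$, $1\le k\le i-1$. Discrete generalized exchange-driven (DGED) system: $\dot c_i=\sum_{j=1}^4 Q_{j,i}(c)$, $i\in\mathbb{N}$, where $$Q_{1,i}(c)=\sum_{k=1}^\infty\sum_{j=0}^\infty a(i+k,j;k)c_{i+k}c_j,\qquad Q_{2,i}(c)=-\sum_{k=1}^\infty\sum_{j=k}^\infty a(j,i;k)c_jc_i,$$ $$Q_{3,i}(c)=\sum_{k=1}^i\sum_{j=k}^\infty a(j,i-k;k)c_jc_{i-k},\qquad Q_{4,i}(c)=-\sum_{k=1}^i\sum_{j=0}^\infty a(i,j;k)c_jc_i .$$ In the isolated case these formulas hold for all $i\in\mathbb{N}$, with $Q_{3,0}=Q_{4,0}=0$. In the non-isolated case they hold for $i\in\mathbb{N}_+$, while $Q_{j,0}=0$ for $j=1,2,3,4$ (so $\dot c_0=0$). Spaces: $X_{0,1}=\{c:\mathbb{N}\to\mathbb{R} : \|c\|:=\sum_{i=0}^\infty(1+i)|c_i|<\infty\}$, $X_{0,1}^+=\{c\in X_{0,1}: c_i\ge 0\ \forall i\}$.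 Mild solution: for $T\in(0,+\infty]$, a (mild) solution on $[0,T)$ with initial condition $c^{\mathrm{in}}\in X_{0,1}^+$ is a sequence of nonnegative functions $c=(c_i):[0,T)\to X_{0,1}^+$ such that for each $i\in\mathbb{N}$ and $t\in(0,T)$: (i) $c_i\in C^0([0,T))$; (ii) $Q_{j,i}(c(\cdot))\in L^1(0,t)$ for $j=1,2,3,4$; (iii) $c_i(t)=c^{\mathrm{in}}_i+\int_0^t\sum_{j=1}^4Q_{j,i}(c(s))\,ds$. *)

theory Defs
  imports "HOL-Analysis.Analysis"
begin

definition rate_coefficients :: "(nat \<Rightarrow> nat \<Rightarrow> nat \<Rightarrow> real) \<Rightarrow> bool" where
  "rate_coefficients a \<longleftrightarrow>
     (\<forall>p q k. 1 \<le> k \<and> k \<le> p \<longrightarrow> 0 \<le> a p q k) \<and>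
     (\<forall>p\<ge>1. a p 0 p = 0) \<and>
     (\<forall>j\<ge>1. \<forall>k\<ge>1. a k j k = a j k j) \<and>
     (\<forall>i k. 1 \<le> k \<and> k < i \<longrightarrow> a i 0 k = a i 0 (i - k))"

definition X01 :: "(nat \<Rightarrow> real) set" where
  "X01 = {c. (\<lambda>i. (1 + real i) * \<bar>c i\<bar>) summable_on UNIV}"

definition X01_plus :: "(nat \<Rightarrow> real) set" where
  "X01_plus = {c \<in> X01. \<forall>i. 0 \<le> c i}"

datatype dged_case = Isolated | Nonisolated

text \<open>In the non-isolated case the zeroth component does not evolve: all four
  contributions vanish there by definition.\<close>

definition frozen :: "dged_case \<Rightarrow> nat \<Rightarrow> bool" where
  "frozen m i \<longleftrightarrow> m = Nonisolated \<and> i = 0"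

definition Q1 :: "dged_case \<Rightarrow> (nat \<Rightarrow> nat \<Rightarrow> nat \<Rightarrow> real) \<Rightarrow> (nat \<Rightarrow> real) \<Rightarrow> nat \<Rightarrow> real" where
  "Q1 m a c i = (if frozen m i then 0 else
     (\<Sum>\<^sub>\<infinity>k\<in>{1..}. \<Sum>\<^sub>\<infinity>j\<in>UNIV. a (i + k) j k * c (i + k) * c j))"

definition Q2 :: "dged_case \<Rightarrow> (nat \<Rightarrow> nat \<Rightarrow> nat \<Rightarrow> real) \<Rightarrow> (nat \<Rightarrow> real) \<Rightarrow> nat \<Rightarrow> real" where
  "Q2 m a c i = (if frozen m i then 0 else
     - (\<Sum>\<^sub>\<infinity>k\<in>{1..}. \<Sum>\<^sub>\<infinity>j\<in>{k..}. a j i k * c j * c i))"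

definition Q3 :: "dged_case \<Rightarrow> (nat \<Rightarrow> nat \<Rightarrow> nat \<Rightarrow> real) \<Rightarrow> (nat \<Rightarrow> real) \<Rightarrow> nat \<Rightarrow> real" where
  "Q3 m a c i = (if frozen m i then 0 else
     (\<Sum>k=1..i. \<Sum>\<^sub>\<infinity>j\<in>{k..}. a j (i - k) k * c j * c (i - k)))"

definition Q4 :: "dged_case \<Rightarrow> (nat \<Rightarrow> nat \<Rightarrow> nat \<Rightarrow> real) \<Rightarrow> (nat \<Rightarrow> real) \<Rightarrow> nat \<Rightarrow> real" where
  "Q4 m a c i = (if frozen m i then 0 else
     - (\<Sum>k=1..i. \<Sum>\<^sub>\<infinity>j\<in>UNIV. a i j k * c j * c i))"

text \<open>A divergent \<^const>\<open>infsum\<close> is 0, so finiteness of the series defining the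
  four contributions has to be required separately.\<close>

definition Q_converges :: "dged_case \<Rightarrow> (nat \<Rightarrow> nat \<Rightarrow> nat \<Rightarrow> real) \<Rightarrow> (nat \<Rightarrow> real) \<Rightarrow> nat \<Rightarrow> bool" where
  "Q_converges m a c i \<longleftrightarrow> frozen m i \<or>
     ((\<forall>k\<ge>1. (\<lambda>j. a (i + k) j k * c (i + k) * c j) summable_on UNIV) \<and>
      (\<lambda>k. \<Sum>\<^sub>\<infinity>j\<in>UNIV. a (i + k) j k * c (i + k) * c j) summable_on {1..} \<and>
      (\<forall>k\<ge>1. (\<lambda>j. a j i k * c j * c i) summable_on {k..}) \<and>
      (\<lambda>k. \<Sum>\<^sub>\<infinity>j\<in>{k..}. a j i k * c j * c i) summable_on {1..} \<and>
      (\<forall>k\<in>{1..i}. (\<lambda>j. a j (i - k) k * c j * c (i - k)) summable_on {k..}) \<and>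
      (\<forall>k\<in>{1..i}. (\<lambda>j. a i j k * c j * c i) summable_on UNIV))"

definition time_interval :: "ereal \<Rightarrow> real set" where
  "time_interval T = {t. 0 \<le> t \<and> ereal t < T}"

text \<open>Membership of the four contributions in \<open>L\<^sup>1(0,t)\<close> means that they are finite
  almost everywhere and Lebesgue integrable on \<open>(0,t)\<close>.\<close>

definition mild_solution ::
  "dged_case \<Rightarrow> (nat \<Rightarrow> nat \<Rightarrow> nat \<Rightarrow> real) \<Rightarrow> ereal \<Rightarrow> (nat \<Rightarrow> real) \<Rightarrow> (real \<Rightarrow> nat \<Rightarrow> real) \<Rightarrow> bool" where
  "mild_solution m a T c_in c \<longleftrightarrow>
     (\<forall>t\<in>time_interval T. c t \<in> X01_plus) \<and>
     (\<forall>i. continuous_on (time_interval T) (\<lambda>t. c t i)) \<and>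
     (\<forall>i. \<forall>t\<in>time_interval T - {0}.
        (AE s\<in>{0<..<t} in lebesgue. Q_converges m a (c s) i) \<and>
        set_integrable lebesgue {0<..<t} (\<lambda>s. Q1 m a (c s) i) \<and>
        set_integrable lebesgue {0<..<t} (\<lambda>s. Q2 m a (c s) i) \<and>
        set_integrable lebesgue {0<..<t} (\<lambda>s. Q3 m a (c s) i) \<and>
        set_integrable lebesgue {0<..<t} (\<lambda>s. Q4 m a (c s) i) \<and>
        c t i = c_in i + (LINT s:{0<..<t}|lebesgue.
          Q1 m a (c s) i + Q2 m a (c s) i + Q3 m a (c s) i + Q4 m a (c s) i))"

text \<open>Derivatives are taken within the set, hence one-sided at the left end of \<open>[0,T)\<close>;
  the library's \<^const>\<open>C1_differentiable_on\<close> would require a two-sided derivative there.\<close>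

definition C1_within :: "real set \<Rightarrow> (real \<Rightarrow> real) \<Rightarrow> bool" where
  "C1_within S f \<longleftrightarrow>
     (\<exists>f'. (\<forall>t\<in>S. (f has_real_derivative f' t) (at t within S)) \<and> continuous_on S f')"

end

theory Submission
  imports Defs
begin

text \<open>The rate bounds give \<open>a(i,j;k) \<le> K i (1 + j)\<close> and
  \<open>\<Sum>k=1..j. a(j,i;k) \<le> K (1 + i) j\<close> with \<open>K = C \<Q>\<close>, so each of the four series is dominated
  termwise by products of the series \<open>\<Sum>(1 + j) c\<^sub>j\<close>. As the first moment is constant and
  \<open>c\<^sub>0\<close> is continuous, the dominating series have continuous sums; a dominated series of continuous
  functions is then continuous too, because sums of nonnegative continuous functions are lower
  semicontinuous. Hence the integrand of the mild formulation is continuous and the fundamental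
  theorem of calculus applies.\<close>

section \<open>Series of continuous functions: semicontinuity, domination, interchange of
  sums\<close>

lemma eventually_less_infsum_nonneg:
  fixes f :: "'i \<Rightarrow> 'a::topological_space \<Rightarrow> real"
  assumes cont: "\<And>i. i \<in> I \<Longrightarrow> continuous_on S (f i)"
    and nonneg: "\<And>i x. i \<in> I \<Longrightarrow> x \<in> S \<Longrightarrow> 0 \<le> f i x"
    and summable: "\<And>x. x \<in> S \<Longrightarrow> (\<lambda>i. f i x) summable_on I"
    and x: "x \<in> S" and y: "y < (\<Sum>\<^sub>\<infinity>i\<in>I. f i x)"
  shows "\<forall>\<^sub>F z in at x within S. y < (\<Sum>\<^sub>\<infinity>i\<in>I. f i z)"
proof -
  have "((\<lambda>i. f i x) has_sum (\<Sum>\<^sub>\<infinity>i\<in>I. f i x)) I"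
    using summable[OF x] by simp
  \<comment> \<open>Some finite partial sum already exceeds \<open>y\<close> at \<open>x\<close>.
    Being continuous, it still does so near \<open>x\<close>, and the omitted terms are
    nonnegative.\<close>
  then have "\<forall>\<^sub>F F in finite_subsets_at_top I. y < (\<Sum>i\<in>F. f i x)"
    unfolding has_sum_def by (rule order_tendstoD(1)) (fact y)
  then obtain F where F: "finite F" "F \<subseteq> I" "y < (\<Sum>i\<in>F. f i x)"
    unfolding eventually_finite_subsets_at_top by blast
  have "continuous_on S (\<lambda>z. \<Sum>i\<in>F. f i z)"
    using F(2) by (intro continuous_on_sum cont) auto
  then have "((\<lambda>z. \<Sum>i\<in>F. f i z) \<longlongrightarrow> (\<Sum>i\<in>F. f i x)) (at x within S)"
    using x by (simp add: continuous_on_def)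
  then have "\<forall>\<^sub>F z in at x within S. y < (\<Sum>i\<in>F. f i z)"
    by (rule order_tendstoD(1)) (fact F(3))
  moreover have "\<forall>\<^sub>F z in at x within S. z \<in> S"
    by (simp add: eventually_at_filter)
  ultimately show ?thesis
  proof eventually_elim
    case (elim z)
    have "(\<Sum>i\<in>F. f i z) \<le> (\<Sum>\<^sub>\<infinity>i\<in>I. f i z)"
      using elim F nonneg by (intro finite_sum_le_infsum summable) auto
    with elim show ?case by simp
  qed
qed

text \<open>Both \<open>g + f\<close> and \<open>g - f\<close> have nonnegative terms, so their sums
  are lower semicontinuous. Subtracting the continuous sum of \<open>g\<close> leaves lower
  semicontinuity of the sums of \<open>f\<close> and of \<open>-f\<close>, which together give
  continuity.\<close>

lemma continuous_on_infsum_dominated: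
  fixes f g :: "'i \<Rightarrow> 'a::topological_space \<Rightarrow> real"
  assumes f: "\<And>i. i \<in> I \<Longrightarrow> continuous_on S (f i)"
    and g: "\<And>i. i \<in> I \<Longrightarrow> continuous_on S (g i)"
    and le: "\<And>i x. i \<in> I \<Longrightarrow> x \<in> S \<Longrightarrow> \<bar>f i x\<bar> \<le> g i x"
    and summable: "\<And>x. x \<in> S \<Longrightarrow> (\<lambda>i. g i x) summable_on I"
    and sum: "continuous_on S (\<lambda>x. \<Sum>\<^sub>\<infinity>i\<in>I. g i x)"
  shows "continuous_on S (\<lambda>x. \<Sum>\<^sub>\<infinity>i\<in>I. f i x)"
  unfolding continuous_on_def
proof (intro ballI order_tendstoI)
  fix x y assume x: "x \<in> S"
  have lower: "\<forall>\<^sub>F z in at x within S. y < (\<Sum>\<^sub>\<infinity>i\<in>I. h i z)"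
    if h: "\<And>i. i \<in> I \<Longrightarrow> continuous_on S (h i)"
      and h_le: "\<And>i x. i \<in> I \<Longrightarrow> x \<in> S \<Longrightarrow> \<bar>h i x\<bar> \<le> g i x"
      and y: "y < (\<Sum>\<^sub>\<infinity>i\<in>I. h i x)"
    for h :: "'i \<Rightarrow> 'a \<Rightarrow> real" and y
  proof -
    let ?G = "\<lambda>z. \<Sum>\<^sub>\<infinity>i\<in>I. g i z" and ?H = "\<lambda>z. \<Sum>\<^sub>\<infinity>i\<in>I. h i z"
    have h_summable: "(\<lambda>i. h i z) summable_on I" if "z \<in> S" for z
    proof -
      have "(\<lambda>i. norm (h i z)) summable_on I"
        by (rule summable_on_comparison_test[OF summable[OF that]]) (use h_le that in auto)
      then show ?thesis by (rule abs_summable_summable)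
    qed
    have add: "(\<Sum>\<^sub>\<infinity>i\<in>I. g i z + h i z) = ?G z + ?H z" if "z \<in> S" for z
      by (rule infsum_add[OF summable[OF that] h_summable[OF that]])
    \<comment> \<open>Half of the gap pays for the semicontinuity of \<open>?G + ?H\<close>, the
      other half for the variation of \<open>?G\<close>.\<close>
    define d where "d = (?H x - y) / 2"
    have d: "d > 0" using y by (simp add: d_def)
    have "\<forall>\<^sub>F z in at x within S. ?G x + ?H x - d < (\<Sum>\<^sub>\<infinity>i\<in>I. g i z + h i z)"
    proof (rule eventually_less_infsum_nonneg[OF _ _ _ x])
      show "0 \<le> g i z + h i z" if "i \<in> I" "z \<in> S" for i z
        using h_le[OF that] by linarith
      show "?G x + ?H x - d < (\<Sum>\<^sub>\<infinity>i\<in>I. g i x + h i x)"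
        using d add[OF x] by simp
    qed (intro continuous_on_add g h summable_on_add summable h_summable; assumption)+
    moreover have "(?G \<longlongrightarrow> ?G x) (at x within S)"
      using sum x by (simp add: continuous_on_def)
    then have "\<forall>\<^sub>F z in at x within S. ?G z < ?G x + d"
      by (rule order_tendstoD(2)) (use d in simp)
    moreover have "\<forall>\<^sub>F z in at x within S. z \<in> S"
      by (simp add: eventually_at_filter)
    ultimately show ?thesis
    proof eventually_elim
      case (elim z)
      then have "?H x - 2 * d < ?H z"
        using add[of z] by linarith
      then show ?case by (simp add: d_def field_simps)
    qed
  qed
  show "\<forall>\<^sub>F z in at x within S. y < (\<Sum>\<^sub>\<infinity>i\<in>I. f i z)" if "y < (\<Sum>\<^sub>\<infinity>i\<in>I. f i x)"
    using f le that by (rule lower)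
  show "\<forall>\<^sub>F z in at x within S. (\<Sum>\<^sub>\<infinity>i\<in>I. f i z) < y" if "(\<Sum>\<^sub>\<infinity>i\<in>I. f i x) < y"
  proof -
    \<comment> \<open>The upper estimate is the lower one for \<open>-f\<close>, which has the same
      majorant.\<close>
    have "\<forall>\<^sub>F z in at x within S. - y < (\<Sum>\<^sub>\<infinity>i\<in>I. - f i z)"
      by (rule lower) (use f le that in \<open>auto intro: continuous_on_minus simp: infsum_uminus\<close>)
    then show ?thesis by (simp add: infsum_uminus)
  qed
qed

text \<open>Tonelli on the triangle \<open>1 \<le> k \<le> j\<close>. Its sections in
  \<open>k\<close> are finite, so by nonnegativity summability of the section sums gives joint
  summability, and both iterated sums equal the double sum.\<close>

lemma infsum_triangle_swap:
  fixes f :: "nat \<Rightarrow> nat \<Rightarrow> real"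
  assumes nonneg: "\<And>j k. 1 \<le> k \<Longrightarrow> k \<le> j \<Longrightarrow> 0 \<le> f j k"
    and summable: "(\<lambda>j. \<Sum>k=1..j. f j k) summable_on UNIV"
  shows "(\<Sum>\<^sub>\<infinity>k\<in>{1..}. \<Sum>\<^sub>\<infinity>j\<in>{k..}. f j k) = (\<Sum>\<^sub>\<infinity>j\<in>UNIV. \<Sum>k=1..j. f j k)"
proof -
  let ?A = "SIGMA j:UNIV. {1..j}" and ?B = "SIGMA k:{1::nat..}. {k..}"
  have A: "(\<lambda>(j, k). f j k) summable_on ?A"
    by (rule summable_on_SigmaI[where g = "\<lambda>j. \<Sum>k=1..j. f j k"])
      (use nonneg summable in auto)
  have bij: "bij_betw (\<lambda>(k, j). (j, k)) ?B ?A"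
    by (rule bij_betwI[where g = "\<lambda>(j, k). (k, j)"]) auto
  have B: "(\<lambda>(k, j). f j k) summable_on ?B"
    using summable_on_reindex_bij_betw[OF bij, of "\<lambda>(j, k). f j k"] A
    by (simp add: case_prod_unfold)
  have "(\<Sum>\<^sub>\<infinity>k\<in>{1..}. \<Sum>\<^sub>\<infinity>j\<in>{k..}. f j k) = (\<Sum>\<^sub>\<infinity>(k, j)\<in>?B. f j k)"
    by (rule infsum_Sigma'_banach[OF B])
  also have "\<dots> = (\<Sum>\<^sub>\<infinity>(j, k)\<in>?A. f j k)"
    using infsum_reindex_bij_betw[OF bij, of "\<lambda>(j, k). f j k"] by (simp add: case_prod_unfold)
  also have "\<dots> = (\<Sum>\<^sub>\<infinity>j\<in>UNIV. \<Sum>\<^sub>\<infinity>k\<in>{1..j}. f j k)"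
    by (rule infsum_Sigma'_banach[OF A, symmetric])
  finally show ?thesis by simp
qed

section \<open>Weighted sums of a nonnegative sequence with continuous moment\<close>

locale continuous_moment =
  fixes S :: "real set" and c :: "real \<Rightarrow> nat \<Rightarrow> real"
  assumes nonneg: "t \<in> S \<Longrightarrow> 0 \<le> c t i"
    and cont: "continuous_on S (\<lambda>t. c t i)"
    and summable: "t \<in> S \<Longrightarrow> (\<lambda>i. (1 + real i) * c t i) summable_on UNIV"
    and cont_moment: "continuous_on S (\<lambda>t. \<Sum>\<^sub>\<infinity>i\<in>UNIV. (1 + real i) * c t i)"
begin

lemma summable_weighted:
  assumes "t \<in> S" and h: "\<And>j. j \<in> A \<Longrightarrow> \<bar>h j\<bar> \<le> K * (1 + real j)"
  shows "(\<lambda>j. h j * c t j) summable_on A"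
proof -
  have "(\<lambda>j. K * ((1 + real j) * c t j)) summable_on UNIV"
    by (rule summable_on_cmult_right[OF summable[OF assms(1)]])
  then have "(\<lambda>j. K * ((1 + real j) * c t j)) summable_on A"
    by (rule summable_on_subset_banach) simp
  then have "(\<lambda>j. norm (h j * c t j)) summable_on A"
    by (rule summable_on_comparison_test)
      (use mult_right_mono[OF h nonneg[OF assms(1)]] nonneg[OF assms(1)] in
        \<open>auto simp: abs_mult mult.assoc\<close>)
  then show ?thesis by (rule abs_summable_summable)
qed

lemma continuous_weighted:
  assumes h: "\<And>j. j \<in> A \<Longrightarrow> \<bar>h j\<bar> \<le> K * (1 + real j)" and K: "0 \<le> K"
  shows "continuous_on S (\<lambda>t. \<Sum>\<^sub>\<infinity>j\<in>A. h j * c t j)"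
proof -
  \<comment> \<open>The coefficients are extended by zero because the majorant is \<open>K\<close>
    times the full moment, whose continuity is given over \<open>UNIV\<close>.\<close>
  have "continuous_on S (\<lambda>t. \<Sum>\<^sub>\<infinity>j\<in>UNIV. (if j \<in> A then h j else 0) * c t j)"
  proof (rule continuous_on_infsum_dominated[where g = "\<lambda>j t. K * ((1 + real j) * c t j)"])
    show "\<bar>(if j \<in> A then h j else 0) * c t j\<bar> \<le> K * ((1 + real j) * c t j)"
      if "t \<in> S" for j t
      using mult_right_mono[OF h nonneg[OF that]] nonneg[OF that] K
      by (auto simp: abs_mult mult.assoc)
    show "continuous_on S (\<lambda>t. \<Sum>\<^sub>\<infinity>j\<in>UNIV. K * ((1 + real j) * c t j))"
      unfolding infsum_cmult_right' by (intro continuous_intros cont_moment)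
    show "continuous_on S (\<lambda>t. K * ((1 + real j) * c t j))" for j
      by (intro continuous_on_mult continuous_on_const cont)
    show "continuous_on S (\<lambda>t. (if j \<in> A then h j else 0) * c t j)" for j
      by (intro continuous_on_mult continuous_on_const cont)
    show "(\<lambda>j. K * ((1 + real j) * c t j)) summable_on UNIV" if "t \<in> S" for t
      by (rule summable_on_cmult_right[OF summable[OF that]])
  qed
  also have "(\<lambda>t. \<Sum>\<^sub>\<infinity>j\<in>UNIV. (if j \<in> A then h j else 0) * c t j) =
      (\<lambda>t. \<Sum>\<^sub>\<infinity>j\<in>A. h j * c t j)"
    by (intro ext infsum_cong_neutral) auto
  finally show ?thesis .
qed

end

section \<open>Continuity of the four rates\<close>

locale dged_bounds = continuous_moment +
  fixes a :: "nat \<Rightarrow> nat \<Rightarrow> nat \<Rightarrow> real" and K :: real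
  assumes K_nonneg: "0 \<le> K"
    and a_nonneg: "1 \<le> k \<Longrightarrow> k \<le> i \<Longrightarrow> 0 \<le> a i j k"
    and a_le: "1 \<le> k \<Longrightarrow> k \<le> i \<Longrightarrow> a i j k \<le> K * real i * (1 + real j)"
    and a_sum_le: "(\<Sum>k=1..i. a i j k) \<le> K * real i * (1 + real j)"
begin

text \<open>This form serves sums over the first argument of \<open>a\<close>, with the second one
  fixed; \<open>abs_a_le_snd\<close> serves the opposite situation.\<close>

lemma abs_a_le_fst: "1 \<le> k \<Longrightarrow> k \<le> i \<Longrightarrow> \<bar>a i j k\<bar> \<le> K * (1 + real j) * (1 + real i)"
  using a_le[of k i j] a_nonneg[of k i j] mult_nonneg_nonneg[OF K_nonneg, of "1 + real j"]
  by (simp add: algebra_simps)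

lemma abs_a_le_snd: "1 \<le> k \<Longrightarrow> k \<le> i \<Longrightarrow> \<bar>a i j k\<bar> \<le> K * real i * (1 + real j)"
  using a_le a_nonneg by simp

text \<open>The inner series is at most \<open>K * (i + k)\<close> times the moment. The outer terms
  are therefore dominated by \<open>K\<close> times the moment times
  \<open>(i + k) * c t (i + k)\<close>, and summing these over \<open>k\<close> gives a product of
  two continuous functions.\<close>

lemma continuous_Q1: "continuous_on S (\<lambda>t. Q1 m a (c t) i)"
proof -
  let ?W = "\<lambda>t. \<Sum>\<^sub>\<infinity>j\<in>UNIV. (1 + real j) * c t j"
  let ?I = "\<lambda>k t. \<Sum>\<^sub>\<infinity>j\<in>UNIV. a (i + k) j k * c t j"
  have cont_I: "continuous_on S (?I k)" if "k \<ge> 1" for k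
    by (rule continuous_weighted[where K = "K * real (i + k)"])
      (use that abs_a_le_snd[of k "i + k"] K_nonneg in simp_all)
  have I_bound: "\<bar>?I k t\<bar> \<le> K * real (i + k) * ?W t" if k: "k \<ge> 1" and t: "t \<in> S" for k t
  proof -
    have "?I k t \<le> (\<Sum>\<^sub>\<infinity>j\<in>UNIV. K * real (i + k) * ((1 + real j) * c t j))"
    proof (rule infsum_mono)
      show "(\<lambda>j. a (i + k) j k * c t j) summable_on UNIV"
        by (rule summable_weighted[OF t, where K = "K * real (i + k)"])
          (use k abs_a_le_snd[of k "i + k"] in simp)
      show "(\<lambda>j. K * real (i + k) * ((1 + real j) * c t j)) summable_on UNIV"
        by (rule summable_on_cmult_right[OF summable[OF t]])
      show "a (i + k) j k * c t j \<le> K * real (i + k) * ((1 + real j) * c t j)" for j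
        using mult_right_mono[OF a_le[of k "i + k" j] nonneg[OF t]] k by (simp add: mult.assoc)
    qed
    moreover have "0 \<le> ?I k t"
      using k t a_nonneg nonneg by (intro infsum_nonneg) auto
    ultimately show ?thesis
      by (simp add: infsum_cmult_right')
  qed
  let ?g = "\<lambda>k t. K * ?W t * (real (i + k) * c t (i + k))"
  \<comment> \<open>The substitution \<open>j = i + k\<close> turns the majorant into a tail of the
    first moment, which \<open>continuous_weighted\<close> covers.\<close>
  have bij: "bij_betw (\<lambda>k. i + k) {1..} {i + 1..}"
    by (rule bij_betwI[where g = "\<lambda>j. j - i"]) auto
  have "continuous_on S (\<lambda>t. \<Sum>\<^sub>\<infinity>k\<in>{1..}. c t (i + k) * ?I k t)"
  proof (rule continuous_on_infsum_dominated[where g = ?g])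
    show "\<bar>c t (i + k) * ?I k t\<bar> \<le> ?g k t" if "k \<in> {1..}" "t \<in> S" for k t
      using mult_left_mono[OF I_bound[of k t] nonneg[of t "i + k"]] that nonneg
      by (simp add: abs_mult mult_ac)
    show "(\<lambda>k. ?g k t) summable_on {1..}" if t: "t \<in> S" for t
    proof -
      have "(\<lambda>j. real j * c t j) summable_on {i + 1..}"
        by (rule summable_weighted[OF t, where K = 1]) auto
      then show ?thesis
        using summable_on_reindex_bij_betw[OF bij, of "\<lambda>j. real j * c t j"]
        by (intro summable_on_cmult_right) simp
    qed
    have eq: "(\<Sum>\<^sub>\<infinity>k\<in>{1..}. ?g k t) = K * ?W t * (\<Sum>\<^sub>\<infinity>j\<in>{i + 1..}. real j * c t j)" for t
      using infsum_reindex_bij_betw[OF bij, of "\<lambda>j. real j * c t j"]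
      by (simp add: infsum_cmult_right')
    show "continuous_on S (\<lambda>t. \<Sum>\<^sub>\<infinity>k\<in>{1..}. ?g k t)"
      unfolding eq
      by (intro continuous_intros cont_moment continuous_weighted[where K = 1]) auto
  qed (intro continuous_on_mult continuous_on_const cont cont_moment cont_I; simp)+
  then show ?thesis
    by (cases "frozen m i") (simp_all add: Q1_def infsum_cmult_right'[symmetric] mult_ac)
qed

text \<open>Summing over \<open>k\<close> first lets \<open>a_sum_le\<close> bound all exchanges
  from \<open>j\<close> by a multiple of \<open>1 + j\<close>. Bounding each coefficient separately
  would cost a further factor \<open>j\<close> and call for a second moment.\<close>

lemma continuous_Q2: "continuous_on S (\<lambda>t. Q2 m a (c t) i)"
proof -
  have h: "\<bar>\<Sum>k=1..j. a j i k\<bar> \<le> K * (1 + real i) * (1 + real j)" for j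
  proof -
    have "0 \<le> (\<Sum>k=1..j. a j i k)"
      by (intro sum_nonneg a_nonneg) auto
    then show ?thesis
      using a_sum_le[of j i] mult_nonneg_nonneg[OF K_nonneg, of "1 + real i"]
      by (simp add: algebra_simps)
  qed
  have swap: "(\<Sum>\<^sub>\<infinity>k\<in>{1..}. \<Sum>\<^sub>\<infinity>j\<in>{k..}. a j i k * c t j) =
      (\<Sum>\<^sub>\<infinity>j\<in>UNIV. (\<Sum>k=1..j. a j i k) * c t j)" if t: "t \<in> S" for t
    unfolding sum_distrib_right
  proof (rule infsum_triangle_swap)
    show "(\<lambda>j. \<Sum>k=1..j. a j i k * c t j) summable_on UNIV"
      using summable_weighted[OF t h] by (simp add: sum_distrib_right)
  qed (use a_nonneg nonneg[OF t] in auto)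
  have "continuous_on S (\<lambda>t. - ((\<Sum>\<^sub>\<infinity>j\<in>UNIV. (\<Sum>k=1..j. a j i k) * c t j) * c t i))"
    by (intro continuous_intros cont continuous_weighted[OF h]) (use K_nonneg in auto)
  then have "continuous_on S
      (\<lambda>t. - ((\<Sum>\<^sub>\<infinity>k\<in>{1..}. \<Sum>\<^sub>\<infinity>j\<in>{k..}. a j i k * c t j) * c t i))"
    by (rule continuous_on_eq) (simp only: swap)
  then show ?thesis
    by (cases "frozen m i") (simp_all add: Q2_def infsum_cmult_left')
qed

text \<open>The outer sum is finite, so it suffices to treat each inner series by
  \<open>continuous_weighted\<close>.\<close>

lemma continuous_Q3: "continuous_on S (\<lambda>t. Q3 m a (c t) i)"
proof -
  have "continuous_on S (\<lambda>t. \<Sum>k=1..i. (\<Sum>\<^sub>\<infinity>j\<in>{k..}. a j (i - k) k * c t j) * c t (i - k))"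
    by (intro continuous_on_sum continuous_on_mult cont continuous_weighted[OF abs_a_le_fst])
      (use K_nonneg in auto)
  then show ?thesis
    by (cases "frozen m i") (simp_all add: Q3_def infsum_cmult_left')
qed

lemma continuous_Q4: "continuous_on S (\<lambda>t. Q4 m a (c t) i)"
proof -
  have "continuous_on S (\<lambda>t. - (\<Sum>k=1..i. (\<Sum>\<^sub>\<infinity>j\<in>UNIV. a i j k * c t j) * c t i))"
    by (intro continuous_on_minus continuous_on_sum continuous_on_mult cont
        continuous_weighted[OF abs_a_le_snd])
      (use K_nonneg in auto)
  then show ?thesis
    by (cases "frozen m i") (simp_all add: Q4_def infsum_cmult_left')
qed

end

section \<open>From the integral equation to continuous differentiability\<close>

lemma C1_within_time_interval_of_integral:
  fixes f F :: "real \<Rightarrow> real"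
  assumes cont: "continuous_on (time_interval T) F"
    and int: "\<And>t. t \<in> time_interval T - {0} \<Longrightarrow> set_integrable lebesgue {0<..<t} F"
    and f: "\<And>t. t \<in> time_interval T - {0} \<Longrightarrow> f t = f 0 + (LINT s:{0<..<t}|lebesgue. F s)"
  shows "C1_within (time_interval T) f"
  unfolding C1_within_def
proof (intro exI conjI ballI)
  fix t assume t: "t \<in> time_interval T"
  \<comment> \<open>A point strictly between \<open>t\<close> and \<open>T\<close> gives a compact
    interval \<open>{0..b}\<close> inside the domain on which the fundamental theorem of calculus
    applies, also when \<open>T\<close> is infinite.\<close>
  then obtain b where "ereal t < ereal b" "ereal b < T"
    using ereal_dense2[of "ereal t" T] by (auto simp: time_interval_def)
  then have b: "t < b" "{0..b} \<subseteq> time_interval T"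
    by (auto simp: time_interval_def intro: le_less_trans[of _ "ereal b"])
  have t0: "0 \<le> t" using t by (simp add: time_interval_def)
  \<comment> \<open>The hypothesis covers only positive times; at \<open>s = 0\<close> the integral
    vanishes. Elsewhere the Lebesgue integral is a gauge integral, unaffected by the two
    endpoints.\<close>
  have f_eq: "f s = f 0 + integral {0..s} F" if "s \<in> {0..b}" for s
  proof (cases "s = 0")
    case False
    then have s: "s \<in> time_interval T - {0}" using that b by auto
    show ?thesis
      using f[OF s] set_lebesgue_integral_eq_integral(2)[OF int[OF s]]
      by (simp add: integral_open_interval_real)
  qed simp
  have "((\<lambda>s. integral {0..s} F) has_real_derivative F t) (at t within {0..b})"
    by (rule integral_has_real_derivative[OF continuous_on_subset[OF cont b(2)]])
      (use t0 b in auto)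
  then have "((\<lambda>s. f 0 + integral {0..s} F) has_real_derivative F t) (at t within {0..b})"
    by (auto intro!: derivative_eq_intros)
  then have "(f has_real_derivative F t) (at t within {0..b})"
    by (rule has_field_derivative_transform_within[where d = 1])
      (use t0 b f_eq[symmetric] in simp_all)
  \<comment> \<open>Both sets coincide below \<open>b\<close>, hence near \<open>t\<close>; at
    \<open>t = 0\<close> both give the right-sided derivative.\<close>
  moreover have "at t within {0..b} = at t within time_interval T"
    by (rule at_within_nhd[where S = "{..<b}"]) (use b in \<open>auto simp: time_interval_def\<close>)
  ultimately show "(f has_real_derivative F t) (at t within time_interval T)"
    by simp
qed (fact cont)

theorem theorem3p6:
  fixes a :: "nat \<Rightarrow> nat \<Rightarrow> nat \<Rightarrow> real"
    and q :: "nat \<Rightarrow> nat \<Rightarrow> real"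
    and C QQ :: real
    and T :: ereal
    and c_in :: "nat \<Rightarrow> real"
    and c :: "real \<Rightarrow> nat \<Rightarrow> real"
    and m :: dged_case
  assumes "rate_coefficients a"
    and "C \<ge> 1" and "QQ \<ge> 1"
    and "\<And>i k. 1 \<le> k \<Longrightarrow> k \<le> i \<Longrightarrow> 0 \<le> q i k"
    and "\<And>i. 1 \<le> i \<Longrightarrow> (\<Sum>k=1..i. real k * real (i - k + 1) * q i k) \<le> QQ * real i"
    and "\<And>i j k. 1 \<le> k \<Longrightarrow> k \<le> i \<Longrightarrow>
           a i j k \<le> C * real (i - k + 1) * real (j + k) * q i k"
    and "0 < T"
    and "c_in \<in> X01_plus"
    and "mild_solution m a T c_in c"
    and "c 0 = c_in"
    and "(\<lambda>t. \<Sum>\<^sub>\<infinity>i\<in>{1..}. real i * c t i) constant_on time_interval T"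
  shows "\<forall>i. C1_within (time_interval T) (\<lambda>t. c t i) \<and>
             (\<lambda>t. c t i) ` time_interval T \<subseteq> {0..}"
proof -
  let ?S = "time_interval T"
  have X: "c t \<in> X01_plus" if "t \<in> ?S" for t
    using assms(9) that by (simp add: mild_solution_def)
  have nonneg: "0 \<le> c t i" if "t \<in> ?S" for t i
    using X[OF that] by (simp add: X01_plus_def)
  have summable: "(\<lambda>i. (1 + real i) * c t i) summable_on UNIV" if "t \<in> ?S" for t
    using X[OF that] by (auto simp: X01_plus_def X01_def)
  have cont: "continuous_on ?S (\<lambda>t. c t i)" for i
    using assms(9) by (simp add: mild_solution_def)
  have a_nonneg: "0 \<le> a i j k" if "1 \<le> k" "k \<le> i" for i j k
    using assms(1) that by (simp add: rate_coefficients_def)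

  \<comment> \<open>Since \<open>1 + i \<le> 2 * i\<close> for \<open>i \<ge> 1\<close>, twice the
    conserved first moment is a majorant with constant sum. Index 0 escapes this bound and is added
    afterwards through the continuity of \<open>c t 0\<close>.\<close>
  have cont_tail: "continuous_on ?S (\<lambda>t. \<Sum>\<^sub>\<infinity>i\<in>{1..}. (1 + real i) * c t i)"
  proof (rule continuous_on_infsum_dominated[where g = "\<lambda>i t. 2 * (real i * c t i)"])
    obtain M where "\<And>t. t \<in> ?S \<Longrightarrow> (\<Sum>\<^sub>\<infinity>i\<in>{1..}. real i * c t i) = M"
      using assms(11) by (auto simp: constant_on_def)
    then show "continuous_on ?S (\<lambda>t. \<Sum>\<^sub>\<infinity>i\<in>{1..}. 2 * (real i * c t i))"
      by (simp add: infsum_cmult_right' cong: continuous_on_cong)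
    show "\<bar>(1 + real i) * c t i\<bar> \<le> 2 * (real i * c t i)" if "i \<in> {1..}" "t \<in> ?S" for i t
      using that nonneg[of t i] mult_right_mono[of 1 "real i" "c t i"]
      by (simp add: abs_mult algebra_simps)
    show "(\<lambda>i. 2 * (real i * c t i)) summable_on {1..}" if t: "t \<in> ?S" for t
    proof -
      have "(\<lambda>i. (1 + real i) * c t i) summable_on {1..}"
        by (rule summable_on_subset_banach[OF summable[OF t]]) simp
      then have "(\<lambda>i. real i * c t i) summable_on {1..}"
        by (rule summable_on_comparison_test)
          (use nonneg[OF t] in \<open>auto simp: algebra_simps\<close>)
      then show ?thesis by (rule summable_on_cmult_right)
    qed
  qed (intro continuous_on_mult continuous_on_const cont)+
  have moment_split: "(\<Sum>\<^sub>\<infinity>i\<in>UNIV. (1 + real i) * c t i) =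
      c t 0 + (\<Sum>\<^sub>\<infinity>i\<in>{1..}. (1 + real i) * c t i)" if t: "t \<in> ?S" for t
  proof -
    have UNIV: "UNIV = insert 0 {1::nat..}" by auto
    show ?thesis
      unfolding UNIV
      by (subst infsum_insert) (auto intro: summable_on_subset_banach[OF summable[OF t]])
  qed
  have cont_moment: "continuous_on ?S (\<lambda>t. \<Sum>\<^sub>\<infinity>i\<in>UNIV. (1 + real i) * c t i)"
    by (rule continuous_on_eq[OF continuous_on_add[OF cont cont_tail]]) (simp only: moment_split)

  define K where "K = C * QQ"
  \<comment> \<open>These are the summands of the hypothesis on \<open>q\<close>. The factor
    \<open>k\<close> in them absorbs \<open>j + k \<le> (1 + j) * k\<close>, valid for
    \<open>k \<ge> 1\<close>; summation over \<open>k\<close> then produces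
    \<open>K = C * QQ\<close>.\<close>
  define w where "w i k = real k * real (i - k + 1) * q i k" for i k
  have w_nonneg: "0 \<le> w i k" if "1 \<le> k" "k \<le> i" for i k
    using assms(4) that by (simp add: w_def)
  have w_sum: "(\<Sum>k=1..i. w i k) \<le> QQ * real i" for i
    using assms(5)[of i] by (cases "i = 0") (auto simp: w_def)
  have a_le_w: "a i j k \<le> C * (1 + real j) * w i k" if "1 \<le> k" "k \<le> i" for i j k
  proof -
    have "real j * 1 \<le> real j * real k"
      using that by (intro mult_left_mono) auto
    then have jk: "real (j + k) \<le> (1 + real j) * real k"
      by (simp add: algebra_simps)
    have "a i j k \<le> (C * real (i - k + 1) * q i k) * real (j + k)"
      using assms(6)[OF that, of j] by (simp add: mult_ac)
    also have "\<dots> \<le> (C * real (i - k + 1) * q i k) * ((1 + real j) * real k)"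
      using assms(2,4) that by (intro mult_left_mono jk) auto
    finally show ?thesis by (simp add: w_def mult_ac)
  qed
  have sum_le: "(\<Sum>k=1..i. a i j k) \<le> K * real i * (1 + real j)" for i j
  proof -
    have "(\<Sum>k=1..i. a i j k) \<le> (\<Sum>k=1..i. C * (1 + real j) * w i k)"
      by (intro sum_mono a_le_w) auto
    also have "\<dots> \<le> C * (1 + real j) * (QQ * real i)"
      unfolding sum_distrib_left[symmetric] using assms(2) by (intro mult_left_mono w_sum) auto
    finally show ?thesis by (simp add: K_def mult_ac)
  qed
  interpret dged_bounds ?S c a K
  proof
    show "0 \<le> K" using assms(2,3) by (simp add: K_def)
    \<comment> \<open>A single coefficient is one term of a nonnegative sum that obeys the same
      bound.\<close>
    show "a i j k \<le> K * real i * (1 + real j)" if "1 \<le> k" "k \<le> i" for i j k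
      using member_le_sum[of k "{1..i}" "a i j"] a_nonneg sum_le[of i j] that by fastforce
  qed (fact nonneg cont summable cont_moment a_nonneg sum_le)+

  show ?thesis
  proof (intro allI conjI)
    fix i
    let ?F = "\<lambda>s. Q1 m a (c s) i + Q2 m a (c s) i + Q3 m a (c s) i + Q4 m a (c s) i"
    show "C1_within ?S (\<lambda>t. c t i)"
    proof (rule C1_within_time_interval_of_integral[where F = ?F])
      show "continuous_on ?S ?F"
        by (intro continuous_on_add continuous_Q1 continuous_Q2 continuous_Q3 continuous_Q4)
    next
      fix t assume "t \<in> ?S - {0}"
      then have *: "set_integrable lebesgue {0<..<t} (\<lambda>s. Q1 m a (c s) i)"
        "set_integrable lebesgue {0<..<t} (\<lambda>s. Q2 m a (c s) i)"
        "set_integrable lebesgue {0<..<t} (\<lambda>s. Q3 m a (c s) i)"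
        "set_integrable lebesgue {0<..<t} (\<lambda>s. Q4 m a (c s) i)"
        "c t i = c_in i + (LINT s:{0<..<t}|lebesgue. ?F s)"
        using assms(9) by (simp_all add: mild_solution_def)
      show "set_integrable lebesgue {0<..<t} ?F"
        by (intro set_integral_add(1) *(1-4))
      show "c t i = c 0 i + (LINT s:{0<..<t}|lebesgue. ?F s)"
        using *(5) assms(10) by simp
    qed
    show "(\<lambda>t. c t i) ` ?S \<subseteq> {0..}"
      using nonneg by auto
  qed
qed

end
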